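(* Let $\varphi,\psi\in\mathcal{F}^{\ast}$. Then for every $n\ge1$, \[\Lambda_n(1,\varphi\,|\,1,\psi)=\sum_{k=1}^n\Big(A^{\psi}_{n,k}(0)\sum_{j=1}^kA^{\varphi}_{j,1}(0)A_{k,j}\Big).\]
   Context: $\mathbb{K}$ is a field of characteristic zero, $\mathcal{F}=\mathbb{K}[[x]]$ with derivation $D$, $\mathcal{F}^{\ast}$ the set of series $g$ with $g(0)=0$, $D(g)(0)\ne0$. Partial Bell polynomials: $B_{0,0}=1$, $B_{n,0}=0$ ($n\ge1$), $B_{n,k}=0$ ($k>n$), and for $1\le k\le n$, $B_{n,k}=\sum\frac{n!}{\prod_ir_i!(i!)^{r_i}}\prod_iX_i^{r_i}$ over non-negative integers with $\sum r_i=k$, $\sum ir_i=n$. $A_{n,k}\in\mathbb{K}[X_1^{-1},X_1,X_2,\ldots]$ is the unique lower triangular family with $A_{0,0}=1$, $A_{n,0}=0$ ($n\ge1$) and $\sum_{j=k}^nA_{n,j}B_{j,k}=\delta_{nk}$. For a polynomial $P$ and function $\varphi$, $P^{\varphi}(0)$ is $P$ with each $X_j$ replaced by $D^j(\varphi)(0)$. Reciprocal polynomials: $\widehat R_m:=\sum_{i=0}^m(-1)^ii!X_0^{-(i+1)}B_{m,i}$. For $a\in\mathcal{F}_1$ (nonzero constant term) with $a_j=D^j(a)(0)$ and $\varphi\in\mathcal{F}^{\ast}$ define $\Gamma^{(1)}_n(a,\varphi):=\sum_{k=1}^n\big(\sum_{j=k}^n\binom nj a_{n-j}B^{\varphi}_{j,k}(0)\big)X_k$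 and $\bar\Gamma^{(1)}_n(a,\varphi):=\sum_{k=0}^n\big(\sum_{j=k}^n\binom jk\widehat R_{j-k}(a_0,\ldots,a_{j-k})A^{\varphi}_{n,j}(0)\big)X_k$. The generalized Lagrange inversion polynomial for $a=b=1$ (constant function) is $\Lambda_n(1,\varphi\,|\,1,\psi):=\bar\Gamma^{(1)}_n(1,\psi)\circ A_{\bullet,1}\circ\Gamma^{(1)}_{\bullet}(1,\varphi)$, i.e. in $\bar\Gamma^{(1)}_n(1,\psi)$ each $X_j$ is replaced by $A_{j,1}(\Gamma^{(1)}_1(1,\varphi),\ldots,\Gamma^{(1)}_j(1,\varphi))$, with $A_{0,1}=0$. *)

theory Defs
  imports "HOL-Library.Poly_Mapping" "HOL-Computational_Algebra.Formal_Power_Series"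
begin

text \<open>
  Laurent polynomials in the indeterminates \<open>X\<^sub>0, X\<^sub>1, X\<^sub>2, \<dots>\<close> are the elements of the
  monoid algebra over the group of finitely supported integer exponent vectors.
\<close>

type_synonym 'a lpoly = "(nat \<Rightarrow>\<^sub>0 int) \<Rightarrow>\<^sub>0 'a"

definition LConst :: "'a \<Rightarrow> 'a::comm_ring_1 lpoly" where
  "LConst c = Poly_Mapping.single 0 c"

definition LVar :: "nat \<Rightarrow> 'a::comm_ring_1 lpoly" where
  "LVar i = Poly_Mapping.single (Poly_Mapping.single i 1) 1"

definition LVar_inv :: "nat \<Rightarrow> 'a::comm_ring_1 lpoly" where
  "LVar_inv i = Poly_Mapping.single (Poly_Mapping.single i (- 1)) 1"

text \<open>The subring \<open>K[X\<^sub>1\<^sup>-\<^sup>1, X\<^sub>1, X\<^sub>2, \<dots>]\<close>.\<close>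

definition bell_ring :: "'a::comm_ring_1 lpoly set" where
  "bell_ring = {P. \<forall>m \<in> Poly_Mapping.keys P.
     Poly_Mapping.lookup m 0 = 0 \<and> (\<forall>i\<ge>2. 0 \<le> Poly_Mapping.lookup m i)}"

text \<open>
  Substitution into Laurent polynomials. The inverse is only meaningful for units; negative powers
  are only ever taken of units below (of \<open>D(\<phi>)(0)\<close>, of the constant term of a series in
  \<open>\<F>\<^sub>1\<close>, and of a nonzero scalar multiple of \<open>X\<^sub>1\<close>).
\<close>

definition unit_inv :: "'r::comm_ring_1 \<Rightarrow> 'r" where
  "unit_inv x = (THE y. x * y = 1)"

definition unit_powi :: "'r::comm_ring_1 \<Rightarrow> int \<Rightarrow> 'r" where
  "unit_powi x k = (if 0 \<le> k then x ^ nat k else unit_inv x ^ nat (- k))"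

definition lsubst :: "('a \<Rightarrow> 'r) \<Rightarrow> (nat \<Rightarrow> 'r) \<Rightarrow> 'a::comm_ring_1 lpoly \<Rightarrow> 'r::comm_ring_1" where
  "lsubst h g P = (\<Sum>m \<in> Poly_Mapping.keys P. h (Poly_Mapping.lookup P m) *
     (\<Prod>i \<in> Poly_Mapping.keys m. unit_powi (g i) (Poly_Mapping.lookup m i)))"

abbreviation leval :: "(nat \<Rightarrow> 'a) \<Rightarrow> 'a::comm_ring_1 lpoly \<Rightarrow> 'a" where
  "leval \<equiv> lsubst (\<lambda>c. c)"

abbreviation lcompose :: "'a::comm_ring_1 lpoly \<Rightarrow> (nat \<Rightarrow> 'a lpoly) \<Rightarrow> 'a lpoly" where
  "lcompose P g \<equiv> lsubst LConst g P"

definition taylor :: "'a::comm_ring_1 fps \<Rightarrow> nat \<Rightarrow> 'a" where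
  "taylor f j = fps_nth ((fps_deriv ^^ j) f) 0"

abbreviation at_zero :: "'a::comm_ring_1 lpoly \<Rightarrow> 'a fps \<Rightarrow> 'a" where
  "at_zero P \<phi> \<equiv> leval (taylor \<phi>) P"

definition Fstar :: "'a::comm_ring_1 fps set" where
  "Fstar = {g. fps_nth g 0 = 0 \<and> fps_nth (fps_deriv g) 0 \<noteq> 0}"

definition bell_types :: "nat \<Rightarrow> nat \<Rightarrow> (nat \<Rightarrow> nat) set" where
  "bell_types n k = {r. (\<forall>i. i \<notin> {1..n} \<longrightarrow> r i = 0) \<and>
     (\<Sum>i=1..n. r i) = k \<and> (\<Sum>i=1..n. i * r i) = n}"

definition bellB :: "nat \<Rightarrow> nat \<Rightarrow> 'a::field_char_0 lpoly" where
  "bellB n k =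
    (if k = 0 then (if n = 0 then 1 else 0)
     else if n < k then 0
     else (\<Sum>r \<in> bell_types n k.
       LConst (fact n / (\<Prod>i=1..n. fact (r i) * fact i ^ r i)) * (\<Prod>i=1..n. LVar i ^ r i)))"

definition is_bellA :: "(nat \<Rightarrow> nat \<Rightarrow> 'a::field_char_0 lpoly) \<Rightarrow> bool" where
  "is_bellA A \<longleftrightarrow>
     (\<forall>n k. A n k \<in> bell_ring) \<and>
     (\<forall>n k. n < k \<longrightarrow> A n k = 0) \<and>
     A 0 0 = 1 \<and> (\<forall>n\<ge>1. A n 0 = 0) \<and>
     (\<forall>n k. k \<le> n \<longrightarrow> (\<Sum>j=k..n. A n j * bellB j k) = (if n = k then 1 else 0))"

definition bellA :: "nat \<Rightarrow> nat \<Rightarrow> 'a::field_char_0 lpoly" where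
  "bellA = (THE A. is_bellA A)"

definition recipR :: "nat \<Rightarrow> 'a::field_char_0 lpoly" where
  "recipR m = (\<Sum>i=0..m. LConst ((- 1) ^ i * fact i) * LVar_inv 0 ^ (i + 1) * bellB m i)"

definition Gam :: "'a::field_char_0 fps \<Rightarrow> 'a fps \<Rightarrow> nat \<Rightarrow> 'a lpoly" where
  "Gam a \<phi> n = (\<Sum>k=1..n.
     LConst (\<Sum>j=k..n. of_nat (n choose j) * taylor a (n - j) * at_zero (bellB j k) \<phi>) * LVar k)"

definition Gam_bar :: "'a::field_char_0 fps \<Rightarrow> 'a fps \<Rightarrow> nat \<Rightarrow> 'a lpoly" where
  "Gam_bar a \<phi> n = (\<Sum>k=0..n.
     LConst (\<Sum>j=k..n. of_nat (j choose k) * leval (taylor a) (recipR (j - k)) *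
       at_zero (bellA n j) \<phi>) * LVar k)"

text \<open>The polynomial \<open>\<Lambda>\<^sub>n(1, \<phi> | 1, \<psi>)\<close>.\<close>

definition Lambda_one :: "nat \<Rightarrow> 'a::field_char_0 fps \<Rightarrow> 'a fps \<Rightarrow> 'a lpoly" where
  "Lambda_one n \<phi> \<psi> = lcompose (Gam_bar 1 \<psi> n) (\<lambda>j. lcompose (bellA j 1) (Gam 1 \<phi>))"


text \<open>Existence and uniqueness of the family \<^const>\<open>bellA\<close>.\<close>

lemma bell_ring_0 [simp]: "0 \<in> bell_ring"
  and bell_ring_1 [simp]: "1 \<in> bell_ring"
  and bell_ring_LConst [simp]: "LConst c \<in> bell_ring"
  by (auto simp: bell_ring_def LConst_def)

lemma bell_ring_LVar [simp]: "1 \<le> i \<Longrightarrow> LVar i \<in> bell_ring"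
  and bell_ring_LVar_inv [simp]: "LVar_inv 1 \<in> bell_ring"
  by (auto simp: bell_ring_def LVar_def LVar_inv_def lookup_single when_def)

lemma bell_ring_add: "P \<in> bell_ring \<Longrightarrow> Q \<in> bell_ring \<Longrightarrow> P + Q \<in> bell_ring"
  unfolding bell_ring_def using Poly_Mapping.keys_add[of P Q] by blast

lemma bell_ring_diff: "P \<in> bell_ring \<Longrightarrow> Q \<in> bell_ring \<Longrightarrow> P - Q \<in> bell_ring"
  unfolding bell_ring_def using Poly_Mapping.keys_diff[of P Q] by blast

lemma bell_ring_mult:
  assumes "P \<in> bell_ring" "Q \<in> bell_ring"
  shows "P * Q \<in> bell_ring"
  using assms Poly_Mapping.keys_mult[of P Q]
  unfolding bell_ring_def by (fastforce simp: lookup_add)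

lemma bell_ring_power: "P \<in> bell_ring \<Longrightarrow> P ^ n \<in> bell_ring"
  by (induction n) (auto simp: bell_ring_mult)

lemma bell_ring_sum: "(\<And>x. x \<in> S \<Longrightarrow> f x \<in> bell_ring) \<Longrightarrow> sum f S \<in> bell_ring"
  by (induction S rule: infinite_finite_induct) (auto simp: bell_ring_add)

lemma bell_ring_prod: "(\<And>x. x \<in> S \<Longrightarrow> f x \<in> bell_ring) \<Longrightarrow> prod f S \<in> bell_ring"
  by (induction S rule: infinite_finite_induct) (auto simp: bell_ring_mult)

lemma bell_ring_bellB: "bellB n k \<in> bell_ring"
  unfolding bellB_def
  by (auto intro!: bell_ring_sum bell_ring_mult bell_ring_prod bell_ring_power)

lemma finite_bell_types: "finite (bell_types n k)"
proof (rule finite_subset)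
  show "bell_types n k \<subseteq> {r. \<forall>i. (i \<in> {1..n} \<longrightarrow> r i \<in> {..k}) \<and> (i \<notin> {1..n} \<longrightarrow> r i = 0)}"
    using member_le_sum[of _ "{1..n}"] by (fastforce simp: bell_types_def)
  show "finite {r. \<forall>i. (i \<in> {1..n} \<longrightarrow> r i \<in> {..k}) \<and> (i \<notin> {1..n} \<longrightarrow> r i = (0::nat))}"
    by (rule finite_set_of_finite_funs) auto
qed

lemma bell_types_diag:
  assumes "1 \<le> k"
  shows "bell_types k k = {(\<lambda>i. if i = 1 then k else 0)}" (is "_ = {?r}")
proof (intro equalityI subsetI)
  fix r assume "r \<in> bell_types k k"
  then have out: "\<And>i. i \<notin> {1..k} \<Longrightarrow> r i = 0"
    and s1: "(\<Sum>i=1..k. r i) = k" and s2: "(\<Sum>i=1..k. i * r i) = k"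
    by (auto simp: bell_types_def)
  have "(\<Sum>i=1..k. i * r i) = (\<Sum>i=1..k. r i + (i - 1) * r i)"
    by (rule sum.cong) (auto simp: algebra_simps)
  then have "(\<Sum>i=1..k. (i - 1) * r i) = 0"
    using s1 s2 by (simp add: sum.distrib)
  then have z: "r i = 0" if "i \<noteq> 1" for i
    using out[of i] that by (cases "i \<in> {1..k}") (fastforce simp: le_Suc_eq)+
  have "(\<Sum>i=1..k. r i) = r 1"
    using assms z by (subst sum.remove[of _ 1]) auto
  then show "r \<in> {?r}"
    using s1 z by auto
next
  fix r assume "r \<in> {?r}"
  moreover have "(\<Sum>i=1..k. if i = 1 then k else 0) = k"
    using assms by (subst sum.remove[of _ 1]) auto
  moreover have "(\<Sum>i=1..k. i * (if i = 1 then k else 0)) = k"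
    using assms by (subst sum.remove[of _ 1]) auto
  ultimately show "r \<in> bell_types k k"
    using assms by (auto simp: bell_types_def)
qed

lemma bellB_diag: "bellB k k = (LVar 1 ^ k :: 'a::field_char_0 lpoly)"
proof (cases "k = 0")
  case False
  have c: "(\<Prod>i=1..k. fact (if i = 1 then k else 0) * fact i ^ (if i = 1 then k else 0)) = (fact k :: 'a)"
    using False by (subst prod.remove[of _ 1]) auto
  have p: "(\<Prod>i=1..k. LVar i ^ (if i = 1 then k else 0)) = (LVar 1 ^ k :: 'a lpoly)"
    using False by (subst prod.remove[of _ 1]) auto
  show ?thesis
    using False unfolding bellB_def
    by (simp add: bell_types_diag c[unfolded One_nat_def] p[unfolded One_nat_def])
       (simp add: LConst_def)
qed (simp add: bellB_def)

lemma LVar_LVar_inv: "LVar i * LVar_inv i = 1"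
  by (simp add: LVar_def LVar_inv_def mult_single single_add[symmetric])

lemma bellB_diag_inv: "bellB k k * LVar_inv 1 ^ k = 1"
  by (simp add: bellB_diag power_mult_distrib[symmetric] LVar_LVar_inv[of 1, simplified])

function bellA_aux :: "nat \<Rightarrow> nat \<Rightarrow> 'a::field_char_0 lpoly" where
  "bellA_aux n k = (if n < k then 0 else
     ((if n = k then 1 else 0) - (\<Sum>j=Suc k..n. bellA_aux n j * bellB j k)) * LVar_inv 1 ^ k)"
  by auto
termination by (relation "measure (\<lambda>(n, k). n - k)") auto

declare bellA_aux.simps [simp del]

lemma bellA_aux_sum:
  assumes "k \<le> n"
  shows "(\<Sum>j=k..n. bellA_aux n j * bellB j k) = (if n = k then 1 else (0 :: 'a::field_char_0 lpoly))"
proof -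
  let ?S = "\<Sum>j=Suc k..n. bellA_aux n j * bellB j k :: 'a lpoly"
  have "(\<Sum>j=k..n. bellA_aux n j * bellB j k) = bellA_aux n k * bellB k k + ?S"
    using assms by (simp add: sum.atLeast_Suc_atMost)
  also have "bellA_aux n k * bellB k k
      = ((if n = k then 1 else 0) - ?S) * (bellB k k * LVar_inv 1 ^ k)"
    using assms by (subst bellA_aux.simps) (simp add: mult_ac)
  finally show ?thesis
    by (simp only: bellB_diag_inv) simp
qed

lemma bellA_aux_0: "bellA_aux n 0 = (if n = 0 then 1 else 0)"
  by (subst bellA_aux.simps) (auto simp: bellB_def)

lemma bellA_aux_in: "bellA_aux n k \<in> (bell_ring :: 'a::field_char_0 lpoly set)"
proof (induction n k rule: bellA_aux.induct)
  case (1 n k)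
  then have "((if n = k then 1 else 0) - (\<Sum>j=Suc k..n. bellA_aux n j * bellB j k)) * LVar_inv 1 ^ k
      \<in> (bell_ring :: 'a lpoly set)" if "\<not> n < k"
    using that
    by (intro bell_ring_mult bell_ring_diff bell_ring_sum bell_ring_power bell_ring_bellB
          bell_ring_LVar_inv) auto
  then show ?case
    by (subst bellA_aux.simps) (simp del: One_nat_def)
qed

lemma bellA_aux_less: "n < k \<Longrightarrow> bellA_aux n k = 0"
  by (subst bellA_aux.simps) simp

lemma is_bellA_aux: "is_bellA bellA_aux"
  unfolding is_bellA_def
  by (intro conjI allI impI bellA_aux_in bellA_aux_sum)
     (simp_all add: bellA_aux_0 bellA_aux_less)

lemma is_bellA_unique:
  assumes A: "is_bellA A"
  shows "A = bellA_aux"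
proof (intro ext)
  fix n k
  show "A n k = bellA_aux n k"
  proof (induction n k rule: bellA_aux.induct)
    case (1 n k)
    show ?case
    proof (cases "n < k")
      case True
      then show ?thesis using A by (simp add: is_bellA_def bellA_aux_less)
    next
      case False
      have "(\<Sum>j=k..n. A n j * bellB j k) = (\<Sum>j=k..n. bellA_aux n j * bellB j k)"
        using False A by (simp add: is_bellA_def bellA_aux_sum)
      moreover have "(\<Sum>j=Suc k..n. A n j * bellB j k) = (\<Sum>j=Suc k..n. bellA_aux n j * bellB j k)"
        using 1 False by (intro sum.cong) auto
      ultimately have "A n k * bellB k k = bellA_aux n k * bellB k k"
        using False by (simp add: sum.atLeast_Suc_atMost)
      then have "A n k * (bellB k k * LVar_inv 1 ^ k) = bellA_aux n k * (bellB k k * LVar_inv 1 ^ k)"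
        by (simp only: mult.assoc[symmetric])
      then show ?thesis by (simp only: bellB_diag_inv mult_1_right)
    qed
  qed
qed

lemma bellA_ex1: "\<exists>!A. is_bellA A"
  using is_bellA_aux is_bellA_unique by blast

lemma is_bellA_bellA: "is_bellA bellA"
  unfolding bellA_def by (rule theI'[OF bellA_ex1])

end

theory Submission
  imports Defs
begin

text \<open>
  Up to factorials, \<open>B\<^sub>n\<^sub>,\<^sub>k\<close> evaluated at \<open>g\<close> is the \<open>n\<close>-th coefficient of the \<open>k\<close>-th power of
  the exponential generating function of \<open>g\<close>. Composing generating functions therefore multiplies
  the triangular arrays \<open>B\<close> and, in the opposite order, their inverses \<open>A\<close>. Since \<open>\<Gamma>\<^sub>\<bullet>(1, \<phi>)\<close>
  belongs to the composition of the generic series with \<open>\<phi>\<close>, substituting it turns \<open>A\<close> into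
  \<open>A A\<^sup>\<phi>\<close>. The first column of this product, multiplied by the array \<open>A\<^sup>\<psi>\<close> that \<open>\<Gamma>\<close>-bar amounts
  to when \<open>a = 1\<close>, is the claimed formula.
\<close>

unbundle fps_syntax

section \<open>Evaluation of Laurent polynomials\<close>

lemma unit_inv_eq:
  fixes x y :: "'r::comm_ring_1"
  assumes "x * y = 1"
  shows "unit_inv x = y"
  unfolding unit_inv_def
proof (rule the_equality)
  fix z assume "x * z = 1"
  then show "z = y"
    using assms by (metis mult.assoc mult.commute mult_1)
qed (rule assms)

lemma unit_inv_right: "x dvd 1 \<Longrightarrow> x * unit_inv x = 1"
  by (auto elim!: dvdE simp: unit_inv_eq)

lemma unit_powi_0 [simp]: "unit_powi x 0 = 1"
  and unit_powi_1 [simp]: "unit_powi x 1 = x"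
  by (simp_all add: unit_powi_def)

lemma unit_powi_diff:
  assumes "x dvd 1"
  shows "unit_powi x (int a - int b) = x ^ a * unit_inv x ^ b"
proof (cases "b \<le> a")
  case True
  then have "x ^ a * unit_inv x ^ b = x ^ (a - b) * (x * unit_inv x) ^ b"
    by (simp add: power_mult_distrib mult.assoc[symmetric] power_add[symmetric])
  then show ?thesis using True assms
    by (simp add: unit_inv_right unit_powi_def nat_diff_distrib)
next
  case False
  then have "x ^ a * unit_inv x ^ b = (x * unit_inv x) ^ a * unit_inv x ^ (b - a)"
    by (simp add: power_mult_distrib mult.assoc power_add[symmetric])
  then show ?thesis using False assms
    by (simp add: unit_inv_right unit_powi_def nat_diff_distrib)
qed

lemma unit_powi_add:
  assumes "x dvd 1 \<or> (0 \<le> k \<and> 0 \<le> l)"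
  shows "unit_powi x (k + l) = unit_powi x k * unit_powi x l"
proof (cases "x dvd 1")
  case True
  obtain a b where k: "k = int a - int b" by (metis int_diff_cases)
  obtain c d where l: "l = int c - int d" by (metis int_diff_cases)
  have "k + l = int (a + c) - int (b + d)" by (simp add: k l)
  then have "unit_powi x (k + l) = x ^ (a + c) * unit_inv x ^ (b + d)"
    by (simp only: unit_powi_diff[OF True])
  then show ?thesis
    by (simp only: k l unit_powi_diff[OF True] power_add mult_ac)
next
  case False
  then show ?thesis using assms by (auto simp: unit_powi_def nat_add_distrib power_add)
qed

definition monom_subst :: "(nat \<Rightarrow> 'r::comm_ring_1) \<Rightarrow> (nat \<Rightarrow>\<^sub>0 int) \<Rightarrow> 'r" where
  "monom_subst g m = (\<Prod>i \<in> Poly_Mapping.keys m. unit_powi (g i) (Poly_Mapping.lookup m i))"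

lemma monom_subst_superset:
  assumes "finite S" "Poly_Mapping.keys m \<subseteq> S"
  shows "monom_subst g m = (\<Prod>i \<in> S. unit_powi (g i) (Poly_Mapping.lookup m i))"
  unfolding monom_subst_def using assms
  by (intro prod.mono_neutral_left) (auto simp: in_keys_iff)

text \<open>
  Substitution is multiplicative only where negative exponents sit at units of \<open>g\<close>, because
  \<^const>\<open>unit_inv\<close> is a junk value elsewhere.
\<close>

definition monom_dom :: "(nat \<Rightarrow> 'r::comm_ring_1) \<Rightarrow> (nat \<Rightarrow>\<^sub>0 int) set" where
  "monom_dom g = {m. \<forall>i. g i dvd 1 \<or> 0 \<le> Poly_Mapping.lookup m i}"

definition subst_dom :: "(nat \<Rightarrow> 'r::comm_ring_1) \<Rightarrow> 'a::comm_ring_1 lpoly set" where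
  "subst_dom g = {P. Poly_Mapping.keys P \<subseteq> monom_dom g}"

lemma monom_dom_add: "m \<in> monom_dom g \<Longrightarrow> m' \<in> monom_dom g \<Longrightarrow> m + m' \<in> monom_dom g"
  by (auto simp: monom_dom_def lookup_add) (metis add_nonneg_nonneg)

lemma monom_subst_add:
  assumes "m \<in> monom_dom g" "m' \<in> monom_dom g"
  shows "monom_subst g (m + m') = monom_subst g m * monom_subst g m'"
proof -
  let ?S = "Poly_Mapping.keys m \<union> Poly_Mapping.keys m'"
  have "monom_subst g (m + m') = (\<Prod>i\<in>?S. unit_powi (g i) (Poly_Mapping.lookup (m + m') i))"
    using Poly_Mapping.keys_add[of m m'] by (intro monom_subst_superset) auto
  also have "\<dots> = (\<Prod>i\<in>?S. unit_powi (g i) (Poly_Mapping.lookup m i)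
      * unit_powi (g i) (Poly_Mapping.lookup m' i))"
    using assms
    by (intro prod.cong refl) (auto simp: lookup_add monom_dom_def intro: unit_powi_add)
  also have "\<dots> = monom_subst g m * monom_subst g m'"
    by (simp add: prod.distrib monom_subst_superset[of ?S])
  finally show ?thesis .
qed

lemma subst_dom_0 [simp]: "0 \<in> subst_dom g"
  and subst_dom_1 [simp]: "1 \<in> subst_dom g"
  and subst_dom_LConst [simp]: "LConst c \<in> subst_dom g"
  and subst_dom_LVar [simp]: "LVar i \<in> subst_dom g"
  by (auto simp: subst_dom_def monom_dom_def LConst_def LVar_def lookup_single when_def)

lemma subst_dom_LVar_inv: "g i dvd 1 \<Longrightarrow> LVar_inv i \<in> subst_dom g"
  by (auto simp: subst_dom_def monom_dom_def LVar_inv_def lookup_single when_def)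

lemma subst_dom_add: "P \<in> subst_dom g \<Longrightarrow> Q \<in> subst_dom g \<Longrightarrow> P + Q \<in> subst_dom g"
  unfolding subst_dom_def using Poly_Mapping.keys_add[of P Q] by blast

lemma subst_dom_mult: "P \<in> subst_dom g \<Longrightarrow> Q \<in> subst_dom g \<Longrightarrow> P * Q \<in> subst_dom g"
  unfolding subst_dom_def using Poly_Mapping.keys_mult[of P Q] monom_dom_add by blast

lemma subst_dom_power: "P \<in> subst_dom g \<Longrightarrow> P ^ n \<in> subst_dom g"
  by (induction n) (auto simp: subst_dom_mult)

lemma subst_dom_sum: "(\<And>x. x \<in> S \<Longrightarrow> f x \<in> subst_dom g) \<Longrightarrow> sum f S \<in> subst_dom g"
  by (induction S rule: infinite_finite_induct) (auto simp: subst_dom_add)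

lemma subst_dom_prod: "(\<And>x. x \<in> S \<Longrightarrow> f x \<in> subst_dom g) \<Longrightarrow> prod f S \<in> subst_dom g"
  by (induction S rule: infinite_finite_induct) (auto simp: subst_dom_mult)

lemma bell_ring_subset_subst_dom:
  assumes "g 1 dvd 1"
  shows "bell_ring \<subseteq> subst_dom g"
proof -
  have "g i dvd 1 \<or> 0 \<le> Poly_Mapping.lookup m i"
    if "Poly_Mapping.lookup m 0 = 0" "\<forall>i\<ge>2. 0 \<le> Poly_Mapping.lookup m i"
    for m :: "nat \<Rightarrow>\<^sub>0 int" and i
    using that assms by (cases "i = 0"; cases "i = 1") auto
  then show ?thesis by (auto simp: bell_ring_def subst_dom_def monom_dom_def)
qed

lemma poly_mapping_eq_sum_single:
  "P = (\<Sum>m \<in> Poly_Mapping.keys P. Poly_Mapping.single m (Poly_Mapping.lookup P m))"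
  by (rule poly_mapping_eqI)
     (auto simp: lookup_sum lookup_single when_def in_keys_iff sum.delta)

locale scalar_hom = additive h for h :: "'a::comm_ring_1 \<Rightarrow> 'r::comm_ring_1" +
  assumes mult: "h (x * y) = h x * h y"
    and one: "h 1 = 1"
begin

lemma prod: "h (prod f S) = (\<Prod>x\<in>S. h (f x))"
  by (induction S rule: infinite_finite_induct) (auto simp: one mult)

lemma power: "h (x ^ n) = h x ^ n"
  by (induction n) (auto simp: one mult)

lemma of_nat: "h (of_nat n) = of_nat n"
  by (induction n) (auto simp: zero one add)

lemma unit_powi:
  assumes "x dvd 1 \<or> 0 \<le> k"
  shows "h (unit_powi x k) = unit_powi (h x) k"
proof (cases "x dvd 1")
  case True
  then have "h x * h (unit_inv x) = 1"
    by (simp add: unit_inv_right one flip: mult)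
  then show ?thesis
    by (simp add: unit_powi_def power unit_inv_eq)
qed (use assms in \<open>simp add: unit_powi_def power\<close>)

lemma hom_lsubst:
  assumes "P \<in> subst_dom g"
  shows "h (lsubst f g P) = lsubst (\<lambda>c. h (f c)) (\<lambda>i. h (g i)) P"
  unfolding lsubst_def sum mult prod
  using assms by (intro sum.cong prod.cong refl arg_cong2[where f = "(*)"] unit_powi)
    (auto simp: subst_dom_def monom_dom_def)

lemma lsubst_superset:
  assumes "finite S" "Poly_Mapping.keys P \<subseteq> S"
  shows "lsubst h g P = (\<Sum>m\<in>S. h (Poly_Mapping.lookup P m) * monom_subst g m)"
  unfolding lsubst_def monom_subst_def[symmetric] using assms
  by (intro sum.mono_neutral_left) (auto simp: in_keys_iff zero)

lemma lsubst_0 [simp]: "lsubst h g 0 = 0"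
  by (simp add: lsubst_def)

lemma lsubst_single: "lsubst h g (Poly_Mapping.single m c) = h c * monom_subst g m"
  by (subst lsubst_superset[of "{m}"]) (auto simp: zero)

lemma lsubst_LConst [simp]: "lsubst h g (LConst c) = h c"
  by (simp add: LConst_def lsubst_single monom_subst_def)

lemma lsubst_1 [simp]: "lsubst h g 1 = 1"
  using lsubst_LConst[of g 1] by (simp add: LConst_def one)

lemma lsubst_LVar [simp]: "lsubst h g (LVar i) = g i"
  by (simp add: one LVar_def lsubst_single monom_subst_def)

lemma lsubst_LVar_inv [simp]: "lsubst h g (LVar_inv i) = unit_inv (g i)"
  by (simp add: one LVar_inv_def lsubst_single monom_subst_def unit_powi_def)

lemma lsubst_add: "lsubst h g (P + Q) = lsubst h g P + lsubst h g Q"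
proof -
  let ?S = "Poly_Mapping.keys P \<union> Poly_Mapping.keys Q"
  have "lsubst h g (P + Q) = (\<Sum>m\<in>?S. h (Poly_Mapping.lookup (P + Q) m) * monom_subst g m)"
    using Poly_Mapping.keys_add[of P Q] by (intro lsubst_superset) auto
  then show ?thesis
    by (simp add: lookup_add add distrib_right sum.distrib lsubst_superset[of ?S])
qed

lemma lsubst_sum: "lsubst h g (sum f S) = (\<Sum>x\<in>S. lsubst h g (f x))"
  by (induction S rule: infinite_finite_induct) (auto simp: lsubst_add)

lemma lsubst_mult:
  assumes "P \<in> subst_dom g" "Q \<in> subst_dom g"
  shows "lsubst h g (P * Q) = lsubst h g P * lsubst h g Q"
proof -
  let ?K = Poly_Mapping.keys and ?l = Poly_Mapping.lookup
  have "P * Q = (\<Sum>m\<in>?K P. \<Sum>m'\<in>?K Q. Poly_Mapping.single (m + m') (?l P m * ?l Q m'))"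
    by (subst (1) poly_mapping_eq_sum_single[of P], subst (1) poly_mapping_eq_sum_single[of Q])
       (simp add: sum_product mult_single)
  then have "lsubst h g (P * Q) = (\<Sum>m\<in>?K P. \<Sum>m'\<in>?K Q.
      h (?l P m * ?l Q m') * monom_subst g (m + m'))"
    by (simp add: lsubst_sum lsubst_single)
  also have "\<dots> = (\<Sum>m\<in>?K P. \<Sum>m'\<in>?K Q.
      (h (?l P m) * monom_subst g m) * (h (?l Q m') * monom_subst g m'))"
    using assms by (intro sum.cong refl)
      (auto simp: subst_dom_def monom_subst_add mult mult_ac subset_iff)
  also have "\<dots> = lsubst h g P * lsubst h g Q"
    by (simp add: sum_product lsubst_def monom_subst_def)
  finally show ?thesis .
qed

lemma lsubst_power: "P \<in> subst_dom g \<Longrightarrow> lsubst h g (P ^ n) = lsubst h g P ^ n"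
  by (induction n) (auto simp: lsubst_mult subst_dom_power)

lemma lsubst_prod:
  "(\<And>x. x \<in> S \<Longrightarrow> f x \<in> subst_dom g) \<Longrightarrow> lsubst h g (prod f S) = (\<Prod>x\<in>S. lsubst h g (f x))"
  by (induction S rule: infinite_finite_induct) (auto simp: lsubst_mult subst_dom_prod)

end

lemma unit_powi_LVar: "unit_powi (LVar i) k = Poly_Mapping.single (Poly_Mapping.single i k) 1"
proof -
  have single_power: "(Poly_Mapping.single (Poly_Mapping.single i e) 1 :: 'a lpoly) ^ n
      = Poly_Mapping.single (Poly_Mapping.single i (int n * e)) 1" for e n
    by (induction n) (simp_all add: mult_single algebra_simps flip: single_add)
  have "unit_inv (LVar i) = (LVar_inv i :: 'a lpoly)"
    by (rule unit_inv_eq[OF LVar_LVar_inv])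
  then show ?thesis
    by (simp add: unit_powi_def LVar_def LVar_inv_def single_power)
qed

lemma monom_subst_LVar: "monom_subst LVar m = Poly_Mapping.single m 1"
proof -
  have "(\<Prod>i\<in>S. Poly_Mapping.single (f i) 1) = (Poly_Mapping.single (sum f S) 1 :: 'a lpoly)"
    for f :: "nat \<Rightarrow> nat \<Rightarrow>\<^sub>0 int" and S
    by (induction S rule: infinite_finite_induct) (simp_all add: mult_single)
  then show ?thesis
    by (simp add: monom_subst_def unit_powi_LVar flip: poly_mapping_eq_sum_single)
qed

lemma lcompose_LVar: "lcompose P LVar = P"
proof -
  have "lcompose P LVar
      = (\<Sum>m\<in>Poly_Mapping.keys P. Poly_Mapping.single m (Poly_Mapping.lookup P m))"
    unfolding lsubst_def monom_subst_def[symmetric]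
    by (simp add: LConst_def monom_subst_LVar mult_single)
  then show ?thesis by (simp flip: poly_mapping_eq_sum_single)
qed


section \<open>The multinomial theorem and powers of formal power series\<close>

definition exponents :: "'b set \<Rightarrow> nat \<Rightarrow> ('b \<Rightarrow> nat) set" where
  "exponents S k = {r. (\<forall>i. i \<notin> S \<longrightarrow> r i = 0) \<and> sum r S = k}"

definition multinomial :: "'b set \<Rightarrow> ('b \<Rightarrow> nat) \<Rightarrow> nat" where
  "multinomial S r = fact (sum r S) div (\<Prod>i\<in>S. fact (r i))"

lemma finite_exponents:
  assumes "finite S"
  shows "finite (exponents S k)"
proof (rule finite_subset)
  show "exponents S k \<subseteq> {r. \<forall>i. (i \<in> S \<longrightarrow> r i \<in> {..k}) \<and> (i \<notin> S \<longrightarrow> r i = 0)}"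
    using member_le_sum[of _ S] assms by (fastforce simp: exponents_def)
  show "finite {r. \<forall>i. (i \<in> S \<longrightarrow> r i \<in> {..k}) \<and> (i \<notin> S \<longrightarrow> r i = (0::nat))}"
    by (rule finite_set_of_finite_funs) (use assms in auto)
qed

lemma exponents_empty: "exponents {} k = (if k = 0 then {\<lambda>_. 0} else {})"
  by (auto simp: exponents_def)

lemma (in comm_monoid_add) sum_if_eq_notin:
  "a \<notin> S \<Longrightarrow> (\<Sum>i\<in>S. if i = a then b else f i) = sum f S"
  by (rule sum.cong) auto

lemma sum_exponents_insert:
  assumes "finite S" "a \<notin> S"
  shows "(\<Sum>r\<in>exponents (insert a S) k. F r) = (\<Sum>j\<le>k. \<Sum>r\<in>exponents S (k - j). F (r(a := j)))"
proof -
  have "(\<Sum>j\<le>k. \<Sum>r\<in>exponents S (k - j). F (r(a := j)))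
      = (\<Sum>(j, r)\<in>Sigma {..k} (\<lambda>j. exponents S (k - j)). F (r(a := j)))"
    using assms by (subst sum.Sigma) (auto simp: finite_exponents)
  also have "\<dots> = (\<Sum>r\<in>exponents (insert a S) k. F r)"
    by (rule sum.reindex_bij_witness[where j = "\<lambda>(j, r). r(a := j)"
          and i = "\<lambda>r. (r a, r(a := 0))"])
       (use assms in \<open>auto simp: exponents_def sum_if_eq_notin fun_upd_idem_iff\<close>)
  finally show ?thesis ..
qed

lemma prod_fact_dvd_fact_sum:
  "finite S \<Longrightarrow> (\<Prod>i\<in>S. fact (r i)) dvd (fact (sum r S) :: nat)"
proof (induction S rule: finite_induct)
  case (insert a S)
  then have "(\<Prod>i\<in>insert a S. fact (r i)) dvd fact (r a) * (fact (sum r S) :: nat)"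
    by (simp add: mult_dvd_mono)
  also have "\<dots> dvd fact (sum r (insert a S))"
    using insert by (simp add: fact_fact_dvd_fact)
  finally show ?case .
qed simp

lemma multinomial_mult_prod_fact:
  "finite S \<Longrightarrow> multinomial S r * (\<Prod>i\<in>S. fact (r i)) = fact (sum r S)"
  by (simp add: multinomial_def prod_fact_dvd_fact_sum)

lemma multinomial_insert:
  assumes "finite S" "a \<notin> S"
  shows "multinomial (insert a S) (r(a := j)) = (j + sum r S choose j) * multinomial S r"
proof -
  let ?p = "\<Prod>i\<in>S. fact (r i) :: nat"
  have "(\<Prod>i\<in>S. fact ((r(a := j)) i)) = ?p"
    using assms by (intro prod.cong) auto
  then have "multinomial (insert a S) (r(a := j)) * (fact j * ?p) = fact (j + sum r S)"
    using multinomial_mult_prod_fact[of "insert a S" "r(a := j)"] assms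
    by (simp add: sum_if_eq_notin)
  also have "\<dots> = (j + sum r S choose j) * fact j * (multinomial S r * ?p)"
    using binomial_fact_lemma[of j "j + sum r S"] assms
    by (simp add: multinomial_mult_prod_fact mult_ac)
  finally show ?thesis using assms by (simp add: mult_ac)
qed

theorem multinomial_ring:
  fixes x :: "'b \<Rightarrow> 'a::comm_semiring_1"
  assumes "finite S"
  shows "(\<Sum>i\<in>S. x i) ^ k = (\<Sum>r\<in>exponents S k. of_nat (multinomial S r) * (\<Prod>i\<in>S. x i ^ r i))"
  using assms
proof (induction S arbitrary: k rule: finite_induct)
  case empty
  then show ?case by (simp add: exponents_empty multinomial_def power_0_left)
next
  case (insert a S)
  define M where "M r = of_nat (multinomial S r) * (\<Prod>i\<in>S. x i ^ r i)" for r
  have M_insert: "of_nat (multinomial (insert a S) (r(a := j)))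
        * (\<Prod>i\<in>insert a S. x i ^ (r(a := j)) i) = of_nat (k choose j) * x a ^ j * M r"
    if "j \<le> k" "r \<in> exponents S (k - j)" for j r
  proof -
    have "(\<Prod>i\<in>S. x i ^ (r(a := j)) i) = (\<Prod>i\<in>S. x i ^ r i)"
      using insert.hyps by (intro prod.cong) auto
    then show ?thesis
      using that insert.hyps by (simp add: multinomial_insert exponents_def M_def mult_ac)
  qed
  have "(\<Sum>i\<in>insert a S. x i) ^ k
      = (\<Sum>j\<le>k. of_nat (k choose j) * x a ^ j * (\<Sum>i\<in>S. x i) ^ (k - j))"
    using insert.hyps by (simp add: binomial_ring)
  also have "\<dots> = (\<Sum>j\<le>k. \<Sum>r\<in>exponents S (k - j). of_nat (k choose j) * x a ^ j * M r)"
    by (simp add: insert.IH sum_distrib_left M_def)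
  also have "\<dots> = (\<Sum>r\<in>exponents (insert a S) k.
      of_nat (multinomial (insert a S) r) * (\<Prod>i\<in>insert a S. x i ^ r i))"
    unfolding sum_exponents_insert[OF insert.hyps]
    by (intro sum.cong refl) (simp only: M_insert atMost_iff)
  finally show ?case .
qed

lemma fps_cutoff_power_nth:
  fixes f :: "'a::comm_ring_1 fps"
  assumes "n < m"
  shows "(fps_cutoff m f ^ k) $ n = (f ^ k) $ n"
  using assms
proof (induction k arbitrary: n)
  case (Suc k)
  then show ?case by (simp add: fps_mult_nth)
qed simp

lemma fps_cutoff_eq_sum:
  fixes f :: "'a::comm_ring_1 fps"
  assumes "f $ 0 = 0"
  shows "fps_cutoff (Suc n) f = (\<Sum>i=1..n. fps_const (f $ i) * fps_X ^ i)"
proof (rule fps_ext)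
  fix m
  show "fps_cutoff (Suc n) f $ m = (\<Sum>i=1..n. fps_const (f $ i) * fps_X ^ i) $ m"
    using assms by (cases "m = 0") (auto simp: fps_sum_nth if_distrib sum.delta' cong: if_cong)
qed

lemma prod_fps_monom_power:
  fixes c :: "nat \<Rightarrow> 'a::comm_ring_1"
  shows "(\<Prod>i\<in>S. (fps_const (c i) * fps_X ^ i) ^ r i)
    = fps_const (\<Prod>i\<in>S. c i ^ r i) * fps_X ^ (\<Sum>i\<in>S. i * r i)"
  by (induction S rule: infinite_finite_induct)
     (simp_all add: power_mult_distrib power_add power_mult fps_const_power mult_ac
       flip: fps_const_mult)

lemma bell_types_eq_exponents:
  "bell_types n k = {r \<in> exponents {1..n} k. (\<Sum>i=1..n. i * r i) = n}"
  by (auto simp: bell_types_def exponents_def)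

theorem fps_power_nth_bell_types:
  fixes f :: "'a::comm_ring_1 fps"
  assumes "f $ 0 = 0"
  shows "(f ^ k) $ n
    = (\<Sum>r\<in>bell_types n k. of_nat (multinomial {1..n} r) * (\<Prod>i=1..n. (f $ i) ^ r i))"
proof -
  let ?c = "\<lambda>r. of_nat (multinomial {1..n} r) * (\<Prod>i=1..n. (f $ i) ^ r i)"
  have "(f ^ k) $ n = ((\<Sum>i=1..n. fps_const (f $ i) * fps_X ^ i) ^ k) $ n"
    using fps_cutoff_power_nth[of n "Suc n" f k] by (simp add: fps_cutoff_eq_sum[OF assms])
  also have "\<dots> = (\<Sum>r\<in>exponents {1..n} k. (fps_const (?c r) * fps_X ^ (\<Sum>i=1..n. i * r i)) $ n)"
    by (simp only: multinomial_ring[OF finite_atLeastAtMost] prod_fps_monom_power fps_sum_nth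
        fps_of_nat[symmetric] fps_const_mult[symmetric] mult.assoc)
  also have "\<dots> = (\<Sum>r\<in>exponents {1..n} k. if (\<Sum>i=1..n. i * r i) = n then ?c r else 0)"
    by (intro sum.cong refl) simp
  also have "\<dots> = (\<Sum>r\<in>bell_types n k. ?c r)"
    unfolding bell_types_eq_exponents
    by (simp only: sum.inter_filter finite_exponents finite_atLeastAtMost)
  finally show ?thesis .
qed


section \<open>Bell polynomials as coefficients of powers\<close>

lemma bell_types_less:
  assumes "n < k"
  shows "bell_types n k = {}"
proof (rule equals0I)
  fix r assume "r \<in> bell_types n k"
  then have "(\<Sum>i=1..n. r i) = k" "(\<Sum>i=1..n. i * r i) = n"
    by (simp_all add: bell_types_def)
  moreover have "(\<Sum>i=1..n. r i) \<le> (\<Sum>i=1..n. i * r i)"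
    by (intro sum_mono) auto
  ultimately show False using assms by linarith
qed

lemma bell_types_0_right: "bell_types n 0 = (if n = 0 then {\<lambda>_. 0} else {})"
  by (auto simp: bell_types_def)

lemma bellB_eq_sum:
  "bellB n k = (\<Sum>r \<in> bell_types n k.
     LConst (fact n / (\<Prod>i=1..n. fact (r i) * fact i ^ r i)) * (\<Prod>i=1..n. LVar i ^ r i))"
  by (auto simp: bellB_def bell_types_less bell_types_0_right LConst_def)

lemma bellB_in_subst_dom: "bellB n k \<in> subst_dom g"
  unfolding bellB_eq_sum
  by (intro subst_dom_sum subst_dom_mult subst_dom_prod subst_dom_power
      subst_dom_LConst subst_dom_LVar)

lemma of_nat_multinomial:
  assumes "finite S"
  shows "(of_nat (multinomial S r) :: 'a::field_char_0) = fact (sum r S) / (\<Prod>i\<in>S. fact (r i))"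
proof -
  have "(of_nat (multinomial S r) :: 'a) * (\<Prod>i\<in>S. fact (r i)) = fact (sum r S)"
    using arg_cong[OF multinomial_mult_prod_fact[OF assms, of r], of "of_nat :: nat \<Rightarrow> 'a"] by simp
  then show ?thesis
    using assms by (simp add: eq_divide_eq)
qed

lemma bell_coeff_eq_multinomial:
  assumes "r \<in> bell_types n k"
  shows "fact n / (\<Prod>i=1..n. fact (r i) * fact i ^ r i)
    = fact n / fact k
      * (of_nat (multinomial {1..n} r) * (\<Prod>i=1..n. (1 / fact i) ^ r i) :: 'a::field_char_0)"
proof -
  have "(of_nat (multinomial {1..n} r) :: 'a) = fact k / (\<Prod>i=1..n. fact (r i))"
    using assms by (simp add: of_nat_multinomial bell_types_def)
  then show ?thesis
    by (simp add: prod.distrib power_one_over prod_dividef)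
qed

locale char_0_scalar_hom = scalar_hom h for h :: "'a::field_char_0 \<Rightarrow> 'r::idom"
begin

definition egf :: "(nat \<Rightarrow> 'r) \<Rightarrow> 'r fps" where
  "egf g = Abs_fps (\<lambda>i. if i = 0 then 0 else h (1 / fact i) * g i)"

lemma egf_nth: "egf g $ i = (if i = 0 then 0 else h (1 / fact i) * g i)"
  by (simp add: egf_def)

abbreviation bellB_at :: "(nat \<Rightarrow> 'r) \<Rightarrow> nat \<Rightarrow> nat \<Rightarrow> 'r" where
  "bellB_at g n k \<equiv> lsubst h g (bellB n k)"

abbreviation bellA_at :: "(nat \<Rightarrow> 'r) \<Rightarrow> nat \<Rightarrow> nat \<Rightarrow> 'r" where
  "bellA_at g n k \<equiv> lsubst h g (bellA n k)"

theorem bellB_at_eq_egf_power: "bellB_at g n k = h (fact n / fact k) * (egf g ^ k) $ n"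
proof -
  have "bellB_at g n k = (\<Sum>r\<in>bell_types n k.
      h (fact n / (\<Prod>i=1..n. fact (r i) * fact i ^ r i)) * (\<Prod>i=1..n. g i ^ r i))"
    unfolding bellB_eq_sum
    by (simp add: lsubst_sum lsubst_mult lsubst_prod lsubst_power subst_dom_prod subst_dom_power)
  also have "\<dots> = (\<Sum>r\<in>bell_types n k. h (fact n / fact k) *
      (of_nat (multinomial {1..n} r) * (\<Prod>i=1..n. (egf g $ i) ^ r i)))"
  proof (intro sum.cong refl)
    fix r assume "r \<in> bell_types n k"
    then have "h (fact n / (\<Prod>i=1..n. fact (r i) * fact i ^ r i))
        = h (fact n / fact k) * (of_nat (multinomial {1..n} r) * (\<Prod>i=1..n. h (1 / fact i) ^ r i))"
      by (simp only: bell_coeff_eq_multinomial mult of_nat prod power)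
    moreover have "(\<Prod>i=1..n. (egf g $ i) ^ r i) = (\<Prod>i=1..n. h (1 / fact i) ^ r i * g i ^ r i)"
      by (intro prod.cong) (auto simp: egf_nth power_mult_distrib)
    ultimately show "h (fact n / (\<Prod>i=1..n. fact (r i) * fact i ^ r i)) * (\<Prod>i=1..n. g i ^ r i)
        = h (fact n / fact k) * (of_nat (multinomial {1..n} r) * (\<Prod>i=1..n. (egf g $ i) ^ r i))"
      by (simp only: prod.distrib mult.assoc)
  qed
  also have "\<dots> = h (fact n / fact k) * (egf g ^ k) $ n"
    by (simp add: fps_power_nth_bell_types egf_nth sum_distrib_left)
  finally show ?thesis .
qed

end


section \<open>Lower triangular arrays\<close>

definition lower_triangular :: "(nat \<Rightarrow> nat \<Rightarrow> 'r::zero) \<Rightarrow> bool" where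
  "lower_triangular P \<longleftrightarrow> (\<forall>n k. n < k \<longrightarrow> P n k = 0)"

definition lower_one :: "nat \<Rightarrow> nat \<Rightarrow> 'r::zero_neq_one" where
  "lower_one n k = (if n = k then 1 else 0)"

text \<open>
  The sum stops at the row index: this is the matrix product only for lower triangular \<open>P\<close>.
\<close>

definition lower_mult ::
  "(nat \<Rightarrow> nat \<Rightarrow> 'r::comm_ring_1) \<Rightarrow> (nat \<Rightarrow> nat \<Rightarrow> 'r) \<Rightarrow> nat \<Rightarrow> nat \<Rightarrow> 'r"
  (infixl \<open>\<odot>\<close> 70) where
  "(P \<odot> Q) n k = (\<Sum>j\<le>n. P n j * Q j k)"

lemma lower_triangularD: "lower_triangular P \<Longrightarrow> n < k \<Longrightarrow> P n k = 0"
  by (simp add: lower_triangular_def)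

lemma lower_triangular_mult:
  "lower_triangular Q \<Longrightarrow> lower_triangular (P \<odot> Q)"
  by (auto simp: lower_triangular_def lower_mult_def intro!: sum.neutral)

lemma lower_mult_one: "lower_triangular P \<Longrightarrow> P \<odot> lower_one = P"
  by (intro ext)
     (simp add: lower_mult_def lower_one_def lower_triangularD if_distrib cong: if_cong)

lemma lower_mult_assoc:
  assumes "lower_triangular Q"
  shows "P \<odot> Q \<odot> R = P \<odot> (Q \<odot> R)"
proof (intro ext)
  fix n k
  have "(P \<odot> Q \<odot> R) n k = (\<Sum>i\<le>n. P n i * (\<Sum>j\<le>n. Q i j * R j k))"
    unfolding lower_mult_def sum_distrib_left sum_distrib_right
    by (subst sum.swap) (simp add: mult.assoc)
  also have "\<dots> = (\<Sum>i\<le>n. P n i * (Q \<odot> R) i k)"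
    unfolding lower_mult_def
    by (intro sum.cong refl arg_cong2[where f = "(*)"] sum.mono_neutral_right)
      (auto simp: lower_triangularD[OF assms])
  finally show "(P \<odot> Q \<odot> R) n k = (P \<odot> (Q \<odot> R)) n k"
    by (simp add: lower_mult_def)
qed

lemma lower_mult_split_diag:
  assumes "lower_triangular B" "k \<le> n"
  shows "(P \<odot> B) n k = P n k * B k k + (\<Sum>j=Suc k..n. P n j * B j k)"
proof -
  have "(P \<odot> B) n k = (\<Sum>j=k..n. P n j * B j k)"
    unfolding lower_mult_def
    by (intro sum.mono_neutral_right) (auto simp: lower_triangularD[OF assms(1)])
  then show ?thesis using assms(2) by (simp add: sum.atLeast_Suc_atMost)
qed

lemma lower_mult_right_cancel:
  assumes P: "lower_triangular P" and Q: "lower_triangular Q" and B: "lower_triangular B"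
    and unit: "\<And>k. B k k dvd 1" and eq: "P \<odot> B = Q \<odot> B"
  shows "P = Q"
proof (intro ext)
  fix n k
  show "P n k = Q n k"
  proof (induction "n - k" arbitrary: k rule: less_induct)
    case less
    show ?case
    proof (cases "n < k")
      case True
      then show ?thesis by (simp add: lower_triangularD P Q)
    next
      case False
      have "(\<Sum>j=Suc k..n. P n j * B j k) = (\<Sum>j=Suc k..n. Q n j * B j k)"
        using less by (intro sum.cong) auto
      then have "P n k * B k k = Q n k * B k k"
        using False fun_cong[OF fun_cong[OF eq], of n k]
        by (simp add: lower_mult_split_diag[OF B])
      moreover obtain c where "B k k * c = 1"
        using unit by (metis dvdE)
      ultimately show ?thesis
        by (metis mult.assoc mult.right_neutral)
    qed
  qed
qed

lemma lower_left_inverse_unique: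
  assumes P: "lower_triangular P" and Q: "lower_triangular Q" and B: "lower_triangular B"
    and PB: "P \<odot> B = lower_one" and QB: "Q \<odot> B = lower_one"
  shows "P = Q"
proof (rule lower_mult_right_cancel[OF P Q B])
  show "B k k dvd 1" for k
  proof
    have "(P \<odot> B) k k = P k k * B k k"
      by (simp add: lower_mult_split_diag[OF B])
    then show "1 = B k k * P k k" by (simp add: PB lower_one_def mult.commute)
  qed
qed (simp add: PB QB)


section \<open>Bell polynomials under composition\<close>

lemma bellB_less: "n < k \<Longrightarrow> bellB n k = 0"
  by (simp add: bellB_def)

lemma bellA_less: "n < k \<Longrightarrow> bellA n k = 0"
  using is_bellA_bellA unfolding is_bellA_def by blast

lemma bellA_in_bell_ring: "bellA n k \<in> bell_ring"
  using is_bellA_bellA unfolding is_bellA_def by blast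

lemma bellA_mult_bellB: "bellA \<odot> bellB = lower_one"
proof (intro ext)
  fix n k
  show "(bellA \<odot> bellB) n k = (lower_one n k :: 'a lpoly)"
  proof (cases "k \<le> n")
    case True
    then have "(bellA \<odot> bellB) n k = (\<Sum>j=k..n. bellA n j * bellB j k :: 'a lpoly)"
      unfolding lower_mult_def by (intro sum.mono_neutral_right) (auto simp: bellB_less)
    also have "\<dots> = lower_one n k"
      using is_bellA_bellA True unfolding is_bellA_def lower_one_def by blast
    finally show ?thesis .
  qed (auto simp: lower_mult_def lower_one_def bellB_less intro!: sum.neutral)
qed

context char_0_scalar_hom
begin

lemma lower_triangular_bellB_at: "lower_triangular (bellB_at g)"
  by (simp add: lower_triangular_def bellB_less)

lemma lower_triangular_bellA_at: "lower_triangular (bellA_at g)"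
  by (simp add: lower_triangular_def bellA_less)

lemma bellA_at_mult_bellB_at:
  assumes "g 1 dvd 1"
  shows "bellA_at g \<odot> bellB_at g = lower_one"
proof (intro ext)
  fix n k
  have "(bellA n j :: 'a lpoly) \<in> subst_dom g" for j
    using bell_ring_subset_subst_dom[of g, OF assms] bellA_in_bell_ring by blast
  then have "(bellA_at g \<odot> bellB_at g) n k = lsubst h g ((bellA \<odot> bellB) n k)"
    by (simp add: lower_mult_def lsubst_sum lsubst_mult bellB_in_subst_dom)
  then show "(bellA_at g \<odot> bellB_at g) n k = lower_one n k"
    by (simp add: bellA_mult_bellB lower_one_def)
qed

text \<open>
  By Faa di Bruno's formula these are, for \<open>n \<ge> 1\<close>, the derivatives at \<open>0\<close> of \<open>f \<circ> \<phi>\<close> when \<open>u\<close>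
  and \<open>t\<close> are those of \<open>f\<close> and of \<open>\<phi>\<close> and \<open>\<phi>(0) = 0\<close>.
\<close>

definition bell_comp :: "(nat \<Rightarrow> 'r) \<Rightarrow> (nat \<Rightarrow> 'r) \<Rightarrow> nat \<Rightarrow> 'r" where
  "bell_comp u t n = (\<Sum>k=1..n. bellB_at t n k * u k)"

lemma egf_bell_comp: "egf (bell_comp u t) = egf u oo egf t"
proof (rule fps_ext)
  fix n
  have "egf (bell_comp u t) $ n = (\<Sum>k=1..n. h (1 / fact n) * (bellB_at t n k * u k))"
    by (simp add: egf_nth bell_comp_def sum_distrib_left)
  also have "\<dots> = (\<Sum>k=1..n. egf u $ k * (egf t ^ k) $ n)"
  proof (intro sum.cong refl)
    fix k assume "k \<in> {1..n}"
    moreover have "h (1 / fact k) = h (1 / fact n) * h (fact n / fact k)"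
      by (simp flip: mult)
    ultimately show "h (1 / fact n) * (bellB_at t n k * u k) = egf u $ k * (egf t ^ k) $ n"
      by (simp add: bellB_at_eq_egf_power egf_nth mult_ac)
  qed
  also have "\<dots> = (egf u oo egf t) $ n"
    unfolding fps_compose_nth by (intro sum.mono_neutral_left) (auto simp: egf_nth not_less_eq_eq)
  finally show "egf (bell_comp u t) $ n = (egf u oo egf t) $ n" .
qed

theorem bellB_at_bell_comp: "bellB_at (bell_comp u t) = bellB_at t \<odot> bellB_at u"
proof (intro ext)
  fix n k
  have "bellB_at (bell_comp u t) n k
      = (\<Sum>j\<le>n. h (fact n / fact k) * ((egf u ^ k) $ j * (egf t ^ j) $ n))"
    by (simp add: bellB_at_eq_egf_power egf_bell_comp fps_compose_power egf_nth fps_compose_nth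
        sum_distrib_left atLeast0AtMost)
  also have "\<dots> = (bellB_at t \<odot> bellB_at u) n k"
    unfolding lower_mult_def
  proof (intro sum.cong refl)
    fix j
    have "h (fact n / fact k) = h (fact n / fact j) * h (fact j / fact k)"
      by (simp flip: mult)
    then show "h (fact n / fact k) * ((egf u ^ k) $ j * (egf t ^ j) $ n)
        = bellB_at t n j * bellB_at u j k"
      by (simp add: bellB_at_eq_egf_power mult_ac)
  qed
  finally show "bellB_at (bell_comp u t) n k = (bellB_at t \<odot> bellB_at u) n k" .
qed

lemma bell_comp_1: "bell_comp u t 1 = t 1 * u 1"
  using bellB_diag[of 1, where 'a = 'a] by (simp add: bell_comp_def)

theorem bellA_at_bell_comp:
  assumes t: "t 1 dvd 1" and u: "u 1 dvd 1"
  shows "bellA_at (bell_comp u t) = bellA_at u \<odot> bellA_at t"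
proof (rule lower_left_inverse_unique)
  have "bell_comp u t 1 dvd 1"
    using mult_dvd_mono[OF t u] by (simp only: bell_comp_1 mult_1)
  then show "bellA_at (bell_comp u t) \<odot> bellB_at (bell_comp u t) = lower_one"
    by (rule bellA_at_mult_bellB_at)
  have "bellA_at u \<odot> bellA_at t \<odot> bellB_at (bell_comp u t)
      = bellA_at u \<odot> (bellA_at t \<odot> bellB_at t) \<odot> bellB_at u"
    by (simp add: bellB_at_bell_comp lower_mult_assoc lower_triangular_bellA_at
        lower_triangular_bellB_at lower_triangular_mult)
  also have "\<dots> = lower_one"
    by (simp add: bellA_at_mult_bellB_at[of t, OF t] bellA_at_mult_bellB_at[of u, OF u]
        lower_mult_one lower_triangular_bellA_at)
  finally show "bellA_at u \<odot> bellA_at t \<odot> bellB_at (bell_comp u t) = lower_one" .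
qed (simp_all add: lower_triangular_bellA_at lower_triangular_bellB_at lower_triangular_mult)

end

interpretation id_hom: char_0_scalar_hom "\<lambda>c::'a::field_char_0. c"
  by unfold_locales simp_all

interpretation LConst_hom: char_0_scalar_hom "LConst :: 'a::field_char_0 \<Rightarrow> 'a lpoly"
  by unfold_locales (simp_all add: LConst_def single_add mult_single)


section \<open>The case of the constant function\<close>

lemma taylor_1: "taylor (1 :: 'a::field_char_0 fps) j = (if j = 0 then 1 else 0)"
  by (simp add: taylor_def fps_0th_higher_deriv)

lemma Gam_1: "Gam 1 \<phi> = LConst_hom.bell_comp LVar (\<lambda>i. LConst (taylor \<phi> i))"
proof
  fix n
  have "(\<Sum>j=k..n. of_nat (n choose j) * taylor 1 (n - j) * at_zero (bellB j k) \<phi>)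
      = at_zero (bellB n k) \<phi>" if "k \<le> n" for k
    using that by (subst sum.remove[of _ n]) (auto intro!: sum.neutral simp: taylor_1)
  then show "Gam 1 \<phi> n = LConst_hom.bell_comp LVar (\<lambda>i. LConst (taylor \<phi> i)) n"
    by (simp add: Gam_def LConst_hom.bell_comp_def LConst_hom.hom_lsubst bellB_in_subst_dom)
qed

lemma at_zero_bellB_1:
  "at_zero (bellB n k) (1 :: 'a::field_char_0 fps) = (if n = 0 \<and> k = 0 then 1 else 0)"
proof -
  have "id_hom.egf (taylor (1 :: 'a fps)) = 0"
    by (rule fps_ext) (simp add: id_hom.egf_nth taylor_1)
  then show ?thesis
    by (simp add: id_hom.bellB_at_eq_egf_power power_0_left)
qed

lemma at_zero_recipR_1:
  "at_zero (recipR m) (1 :: 'a::field_char_0 fps) = (if m = 0 then 1 else 0)"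
proof -
  have "(LVar_inv 0 :: 'a lpoly) \<in> subst_dom (taylor (1 :: 'a fps))"
    by (rule subst_dom_LVar_inv) (simp add: taylor_1)
  then have "at_zero (recipR m) (1 :: 'a fps) = (\<Sum>i=0..m. (- 1) ^ i * fact i
      * unit_inv (taylor 1 0) ^ (i + 1) * at_zero (bellB m i) 1)"
    unfolding recipR_def
    by (simp only: id_hom.lsubst_sum id_hom.lsubst_mult id_hom.lsubst_power id_hom.lsubst_LConst
        id_hom.lsubst_LVar_inv subst_dom_mult subst_dom_power subst_dom_LConst bellB_in_subst_dom)
  then show ?thesis
    by (auto simp: at_zero_bellB_1 taylor_1 unit_inv_eq intro!: sum.neutral)
qed

lemma Gam_bar_1: "Gam_bar 1 \<psi> n = (\<Sum>k=0..n. LConst (at_zero (bellA n k) \<psi>) * LVar k)"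
proof -
  have "(\<Sum>j=k..n. of_nat (j choose k) * at_zero (recipR (j - k)) 1 * at_zero (bellA n j) \<psi>)
      = at_zero (bellA n k) \<psi>" if "k \<le> n" for k
    using that by (subst sum.remove[of _ k]) (auto intro!: sum.neutral simp: at_zero_recipR_1)
  then show ?thesis by (simp add: Gam_bar_def)
qed

lemma LConst_unit: "c \<noteq> 0 \<Longrightarrow> LConst c dvd (1 :: 'a::field lpoly)"
  by (rule dvdI[of _ _ "LConst (1 / c)"]) (simp add: LConst_def mult_single)

lemma lcompose_bellA_Gam_1:
  assumes "\<phi> \<in> Fstar"
  shows "lcompose (bellA n k) (Gam 1 \<phi>) = (\<Sum>j\<le>n. LConst (at_zero (bellA j k) \<phi>) * bellA n j)"
proof -
  have t: "taylor \<phi> 1 \<noteq> 0"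
    using assms by (simp add: Fstar_def taylor_def)
  have "LVar 1 dvd (1 :: 'a lpoly)"
    by (metis LVar_LVar_inv dvd_triv_left)
  then have "lcompose (bellA n k) (Gam 1 \<phi>)
      = (LConst_hom.bellA_at LVar \<odot> LConst_hom.bellA_at (\<lambda>i. LConst (taylor \<phi> i))) n k"
    unfolding Gam_1
    by (intro fun_cong[OF fun_cong[OF LConst_hom.bellA_at_bell_comp]] LConst_unit[OF t])
  moreover have "(bellA j k :: 'a lpoly) \<in> subst_dom (taylor \<phi>)" for j
    using t bell_ring_subset_subst_dom bellA_in_bell_ring
    by (metis dvd_field_iff subsetD)
  ultimately show ?thesis
    by (simp add: lower_mult_def lcompose_LVar LConst_hom.hom_lsubst mult.commute)
qed

theorem theorem7p10:
  fixes \<phi> \<psi> :: "'a::field_char_0 fps" and n :: nat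
  assumes "\<phi> \<in> Fstar" and "\<psi> \<in> Fstar" and "n \<ge> 1"
  shows "Lambda_one n \<phi> \<psi> =
    (\<Sum>k=1..n. LConst (at_zero (bellA n k) \<psi>) *
       (\<Sum>j=1..k. LConst (at_zero (bellA j 1) \<phi>) * bellA k j))"
proof -
  have column: "lcompose (bellA k 1) (Gam 1 \<phi>)
      = (\<Sum>j=1..k. LConst (at_zero (bellA j 1) \<phi>) * bellA k j)" for k
    unfolding lcompose_bellA_Gam_1[OF assms(1)]
    by (intro sum.mono_neutral_right) (auto simp: bellA_less not_less_eq_eq LConst_hom.zero)
  have "Lambda_one n \<phi> \<psi>
      = (\<Sum>k=0..n. LConst (at_zero (bellA n k) \<psi>) * lcompose (bellA k 1) (Gam 1 \<phi>))"
    unfolding Lambda_one_def Gam_bar_1 by (simp add: LConst_hom.lsubst_sum LConst_hom.lsubst_mult)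
  also have "\<dots> = (\<Sum>k=1..n. LConst (at_zero (bellA n k) \<psi>) * lcompose (bellA k 1) (Gam 1 \<phi>))"
    unfolding column by (intro sum.mono_neutral_right) (auto simp: not_less_eq_eq)
  finally show ?thesis unfolding column .
qed

end
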